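(* Let $G$ be a group and consider the isometric action of $G$ by conjugation on the metric graph $\mathcal{S}(G)$ of finite index subgroups of $G$; let $K(G)$ be the kernel of this action. (1) If $G$ is residually finite then $K(G)$ is contained in the second centre $Z_2(G)$. (2) The action is faithful if and only if $G$ is residually finite with trivial centre.
   Context: The vertices of the graph $\mathcal{S}(G)$ are the finite index subgroups of $G$; two vertices are joined by an edge if one is a maximal subgroup of the other. For finite index subgroups $A,B$ put $\mathrm{d}(A,B)=\log\big([A:A\cap B][B:A\cap B]\big)$; the edge joining $A$ and $B$ is an isometric copy of the interval $[0,\mathrm{d}(A,B)]$, and $\mathcal{S}(G)$ carries the resulting path metric. An element $g\in G$ acts by sending each vertex $H$ to $gHg^{-1}$ and edges correspondingly. Thus $K(G)$ is the intersection of the normalisers in $G$ of all finite index subgroups of $G$. $Z_2(G)$ is the preimage in $G$ of the centre of $G/Z(G)$, where $Z(G)$ is the centre of $G$. A group is residually finite if the intersection of its finite index subgroups is trivial. *)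

theory Defs
  imports "HOL-Analysis.Analysis" "HOL-Algebra.Group_Action"
begin

section \<open>Group theory\<close>

definition fin_index_subgroups :: "('a, 'b) monoid_scheme \<Rightarrow> 'a set set" where
  "fin_index_subgroups G = {H. subgroup H G \<and> finite (rcosets\<^bsub>G\<^esub> H)}"

definition maximal_subgroup :: "('a, 'b) monoid_scheme \<Rightarrow> 'a set \<Rightarrow> 'a set \<Rightarrow> bool" where
  "maximal_subgroup G A B \<longleftrightarrow> subgroup A G \<and> subgroup B G \<and> A \<subset> B \<and>
     (\<forall>C. subgroup C G \<longrightarrow> A \<subseteq> C \<longrightarrow> C \<subseteq> B \<longrightarrow> C = A \<or> C = B)"

definition index_in :: "('a, 'b) monoid_scheme \<Rightarrow> 'a set \<Rightarrow> 'a set \<Rightarrow> nat" where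
  "index_in G A C = card (rcosets\<^bsub>G\<lparr>carrier := A\<rparr>\<^esub> C)"

definition residually_finite :: "('a, 'b) monoid_scheme \<Rightarrow> bool" where
  "residually_finite G \<longleftrightarrow> \<Inter> (fin_index_subgroups G) = {\<one>\<^bsub>G\<^esub>}"

definition center :: "('a, 'b) monoid_scheme \<Rightarrow> 'a set" where
  "center G = {z \<in> carrier G. \<forall>x \<in> carrier G. z \<otimes>\<^bsub>G\<^esub> x = x \<otimes>\<^bsub>G\<^esub> z}"

definition second_center :: "('a, 'b) monoid_scheme \<Rightarrow> 'a set" where
  "second_center G = {g \<in> carrier G. center G #>\<^bsub>G\<^esub> g \<in> center (G Mod center G)}"

definition conj_set :: "('a, 'b) monoid_scheme \<Rightarrow> 'a \<Rightarrow> 'a set \<Rightarrow> 'a set" where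
  "conj_set G g H = g <#\<^bsub>G\<^esub> H #>\<^bsub>G\<^esub> (inv\<^bsub>G\<^esub> g)"

section \<open>The metric graph of finite index subgroups\<close>

definition sg_adj :: "('a, 'b) monoid_scheme \<Rightarrow> 'a set \<Rightarrow> 'a set \<Rightarrow> bool" where
  "sg_adj G A B \<longleftrightarrow> A \<in> fin_index_subgroups G \<and> B \<in> fin_index_subgroups G \<and>
     (maximal_subgroup G A B \<or> maximal_subgroup G B A)"

definition sg_length :: "('a, 'b) monoid_scheme \<Rightarrow> 'a set \<Rightarrow> 'a set \<Rightarrow> real" where
  "sg_length G A B = ln (real (index_in G A (A \<inter> B) * index_in G B (A \<inter> B)))"

text \<open>
  The graph has no loops and no multiple edges, so a point of its geometric realisation is given
  by barycentric coordinates: a function on the vertices that is nonnegative, sums to one, and is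
  supported either on a single vertex or on the two ends of an edge. The point of the edge
  joining \<open>A\<close> and \<open>B\<close> that corresponds to \<open>t \<in> [0, d(A,B)]\<close> has coordinates
  \<open>1 - t / d(A,B)\<close> at \<open>A\<close> and \<open>t / d(A,B)\<close> at \<open>B\<close>.
\<close>

definition sg_vertex :: "'a set \<Rightarrow> 'a set \<Rightarrow> real" where
  "sg_vertex A = (\<lambda>H. if H = A then 1 else 0)"

definition sg_edge :: "'a set \<Rightarrow> 'a set \<Rightarrow> ('a set \<Rightarrow> real) set" where
  "sg_edge A B = {p. 0 \<le> p A \<and> 0 \<le> p B \<and> p A + p B = 1 \<and> (\<forall>H. H \<noteq> A \<longrightarrow> H \<noteq> B \<longrightarrow> p H = 0)}"

definition sg_space :: "('a, 'b) monoid_scheme \<Rightarrow> ('a set \<Rightarrow> real) set" where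
  "sg_space G = sg_vertex ` fin_index_subgroups G \<union> (\<Union>{sg_edge A B | A B. sg_adj G A B})"

text \<open>
  \<open>sg_path G p q l\<close>: there is a piecewise linear path of length \<open>l\<close> from \<open>p\<close> to \<open>q\<close>, i.e. a
  finite concatenation of segments each contained in a closed edge. Since the edge joining
  \<open>A\<close> and \<open>B\<close> has length \<open>d(A,B)\<close>, the segment from \<open>p\<close> to \<open>q\<close> in it has
  length \<open>d(A,B) \<cdot> \<bar>p A - q A\<bar>\<close>.
\<close>

inductive sg_path ::
  "('a, 'b) monoid_scheme \<Rightarrow> ('a set \<Rightarrow> real) \<Rightarrow> ('a set \<Rightarrow> real) \<Rightarrow> real \<Rightarrow> bool"
  for G where
  refl: "p \<in> sg_space G \<Longrightarrow> sg_path G p p 0"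
| step: "\<lbrakk>sg_adj G A B; p \<in> sg_edge A B; q \<in> sg_edge A B; sg_path G q r l\<rbrakk>
          \<Longrightarrow> sg_path G p r (sg_length G A B * \<bar>p A - q A\<bar> + l)"

text \<open>The value off the space is irrelevant; it is chosen to suit the locale \<open>Metric_space\<close>.\<close>

definition sg_dist ::
  "('a, 'b) monoid_scheme \<Rightarrow> ('a set \<Rightarrow> real) \<Rightarrow> ('a set \<Rightarrow> real) \<Rightarrow> real" where
  "sg_dist G p q = (if p \<in> sg_space G \<and> q \<in> sg_space G then Inf {l. sg_path G p q l} else 0)"

section \<open>The action by conjugation\<close>

definition IsomGroup :: "'p set \<Rightarrow> ('p \<Rightarrow> 'p \<Rightarrow> real) \<Rightarrow> ('p \<Rightarrow> 'p) monoid" where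
  "IsomGroup M d = BijGroup M
     \<lparr>carrier := {f \<in> Bij M. \<forall>x \<in> M. \<forall>y \<in> M. d (f x) (f y) = d x y}\<rparr>"

text \<open>
  The affine extension of \<open>A \<mapsto> g A g\<inverse>\<close>: the coordinate of \<open>g \<cdot> p\<close> at \<open>H\<close> is the coordinate
  of \<open>p\<close> at \<open>g\<inverse> H g\<close>, so that the vertex \<open>A\<close> goes to \<open>g A g\<inverse>\<close>
  (lemma \<open>sg_action_vertex\<close>).
\<close>

definition sg_action ::
  "('a, 'b) monoid_scheme \<Rightarrow> 'a \<Rightarrow> ('a set \<Rightarrow> real) \<Rightarrow> ('a set \<Rightarrow> real)" where
  "sg_action G g = (\<lambda>p \<in> sg_space G. \<lambda>H.
     if H \<in> fin_index_subgroups G then p (conj_set G (inv\<^bsub>G\<^esub> g) H) else 0)"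

definition sg_kernel :: "('a, 'b) monoid_scheme \<Rightarrow> 'a set" where
  "sg_kernel G = kernel G (IsomGroup (sg_space G) (sg_dist G)) (sg_action G)"

section \<open>Well-definedness: the path metric is a metric and the action is isometric\<close>

context group
begin

lemma conj_set_image: "conj_set G g H = (\<lambda>x. g \<otimes> x \<otimes> inv g) ` H"
  by (auto simp: conj_set_def l_coset_def r_coset_def)

lemma conj_set_mult:
  assumes "g \<in> carrier G" "h \<in> carrier G" "H \<subseteq> carrier G"
  shows "conj_set G (g \<otimes> h) H = conj_set G g (conj_set G h H)"
  unfolding conj_set_image image_image
  by (rule image_cong) (use assms in \<open>auto simp: m_assoc inv_mult_group subset_iff\<close>)

lemma conj_set_one: "H \<subseteq> carrier G \<Longrightarrow> conj_set G \<one> H = H"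
  unfolding conj_set_image by (force simp: subset_iff)

lemma conj_set_subset: "\<lbrakk>g \<in> carrier G; H \<subseteq> carrier G\<rbrakk> \<Longrightarrow> conj_set G g H \<subseteq> carrier G"
  unfolding conj_set_image by auto

lemma conj_set_inv [simp]:
  assumes "g \<in> carrier G" "H \<subseteq> carrier G"
  shows "conj_set G (inv g) (conj_set G g H) = H" "conj_set G g (conj_set G (inv g) H) = H"
  using assms by (simp_all flip: conj_set_mult add: conj_set_one)

lemma fin_index_subset: "H \<in> fin_index_subgroups G \<Longrightarrow> H \<subseteq> carrier G"
  by (simp add: fin_index_subgroups_def subgroup.subset)

lemma conj_set_subgroup: "\<lbrakk>g \<in> carrier G; subgroup H G\<rbrakk> \<Longrightarrow> subgroup (conj_set G g H) G"
  unfolding conj_set_def using subgroup_conjugation_is_surj2 by blast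

lemma inj_on_conj: "g \<in> carrier G \<Longrightarrow> inj_on (\<lambda>x. g \<otimes> x \<otimes> inv g) (carrier G)"
  by (rule inj_onI) simp

lemma rcosets_conj_set:
  assumes g: "g \<in> carrier G" and A: "A \<subseteq> carrier G" and C: "C \<subseteq> carrier G"
  shows "rcosets\<^bsub>G\<lparr>carrier := conj_set G g A\<rparr>\<^esub> (conj_set G g C)
           = conj_set G g ` (rcosets\<^bsub>G\<lparr>carrier := A\<rparr>\<^esub> C)"
proof -
  have "conj_set G g C #> (g \<otimes> a \<otimes> inv g) = conj_set G g (C #> a)" if a: "a \<in> A" for a
  proof -
    have "(g \<otimes> c \<otimes> inv g) \<otimes> (g \<otimes> a \<otimes> inv g) = g \<otimes> (c \<otimes> a) \<otimes> inv g" if "c \<in> C" for c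
    proof -
      have "c \<in> carrier G" "a \<in> carrier G"
        using that a A C by auto
      moreover have "inv g \<otimes> (g \<otimes> y) = y" if "y \<in> carrier G" for y
        using g that by (simp flip: m_assoc)
      ultimately show ?thesis
        using g by (simp add: m_assoc)
    qed
    then show ?thesis
      unfolding conj_set_image r_coset_def by auto
  qed
  then show ?thesis
    unfolding RCOSETS_def conj_set_image[of g A] by (auto simp: r_coset_def)
qed

lemma inj_on_conj_set: "g \<in> carrier G \<Longrightarrow> inj_on (conj_set G g) (Pow (carrier G))"
  by (metis PowD conj_set_inv(1) inj_onI)

lemma index_in_conj_set:
  assumes "g \<in> carrier G" "A \<subseteq> carrier G" "C \<subseteq> carrier G"
  shows "index_in G (conj_set G g A) (conj_set G g C) = index_in G A C"
  unfolding index_in_def rcosets_conj_set[OF assms]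
proof (rule card_image, rule inj_on_subset[OF inj_on_conj_set])
  show "rcosets\<^bsub>G\<lparr>carrier := A\<rparr>\<^esub> C \<subseteq> Pow (carrier G)"
    using assms by (force simp: RCOSETS_def r_coset_def)
qed (use assms in auto)

lemma conj_set_mono: "A \<subseteq> B \<Longrightarrow> conj_set G g A \<subseteq> conj_set G g B"
  unfolding conj_set_image by auto

lemma conj_set_carrier: "g \<in> carrier G \<Longrightarrow> conj_set G g (carrier G) = carrier G"
  using conj_set_mono[OF conj_set_subset[of "inv g" "carrier G"], of g]
  by (simp add: subset_antisym conj_set_subset)

lemma conj_set_fin_index:
  assumes g: "g \<in> carrier G" and H: "H \<in> fin_index_subgroups G"
  shows "conj_set G g H \<in> fin_index_subgroups G"
proof -
  have "rcosets (conj_set G g H) = conj_set G g ` (rcosets H)"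
    using rcosets_conj_set[OF g subset_refl fin_index_subset[OF H]]
    by (simp add: conj_set_carrier g)
  then show ?thesis
    using assms by (simp add: fin_index_subgroups_def conj_set_subgroup)
qed

lemma maximal_subgroup_conj_set:
  assumes g: "g \<in> carrier G" and m: "maximal_subgroup G A B"
  shows "maximal_subgroup G (conj_set G g A) (conj_set G g B)"
proof -
  have sub: "subgroup A G" "subgroup B G" "A \<subset> B"
    and max: "\<And>C. \<lbrakk>subgroup C G; A \<subseteq> C; C \<subseteq> B\<rbrakk> \<Longrightarrow> C = A \<or> C = B"
    using m by (auto simp: maximal_subgroup_def)
  have AB: "A \<subseteq> carrier G" "B \<subseteq> carrier G"
    using sub by (auto simp: subgroup.subset)
  have "C = conj_set G g A \<or> C = conj_set G g B"
    if C: "subgroup C G" "conj_set G g A \<subseteq> C" "C \<subseteq> conj_set G g B" for C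
  proof -
    have "conj_set G (inv g) C = A \<or> conj_set G (inv g) C = B"
      using max[of "conj_set G (inv g) C"] conj_set_subgroup[of "inv g" C] C g AB
        conj_set_mono[OF C(2), of "inv g"] conj_set_mono[OF C(3), of "inv g"] by simp
    then show ?thesis
      using conj_set_inv(2)[OF g subgroup.subset[OF C(1)]] by auto
  qed
  moreover have "conj_set G g A \<subset> conj_set G g B"
    using conj_set_mono[of A B g] sub(3) conj_set_inv(1)[OF g AB(1)] conj_set_inv(1)[OF g AB(2)]
    by (metis psubset_eq)
  ultimately show ?thesis
    unfolding maximal_subgroup_def using conj_set_subgroup g sub by blast
qed

lemma sg_adj_conj_set:
  "\<lbrakk>g \<in> carrier G; sg_adj G A B\<rbrakk> \<Longrightarrow> sg_adj G (conj_set G g A) (conj_set G g B)"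
  unfolding sg_adj_def using conj_set_fin_index maximal_subgroup_conj_set by blast

lemma sg_length_conj_set:
  assumes "g \<in> carrier G" "A \<subseteq> carrier G" "B \<subseteq> carrier G"
  shows "sg_length G (conj_set G g A) (conj_set G g B) = sg_length G A B"
proof -
  have "conj_set G g A \<inter> conj_set G g B = conj_set G g (A \<inter> B)"
    unfolding conj_set_image using inj_on_image_Int[OF inj_on_conj] assms by metis
  then show ?thesis
    using assms by (simp add: sg_length_def index_in_conj_set le_infI1)
qed

lemma sg_adj_subset: "sg_adj G A B \<Longrightarrow> A \<subseteq> carrier G \<and> B \<subseteq> carrier G"
  by (simp add: sg_adj_def fin_index_subset)

lemma sg_vertex_in_space: "A \<in> fin_index_subgroups G \<Longrightarrow> sg_vertex A \<in> sg_space G"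
  by (simp add: sg_space_def)

lemma sg_edge_in_space: "\<lbrakk>sg_adj G A B; p \<in> sg_edge A B\<rbrakk> \<Longrightarrow> p \<in> sg_space G"
  by (auto simp: sg_space_def)

lemma sg_space_cases:
  assumes "p \<in> sg_space G"
  obtains A where "A \<in> fin_index_subgroups G" "p = sg_vertex A"
  | A B where "sg_adj G A B" "p \<in> sg_edge A B"
  using assms unfolding sg_space_def by blast

lemma sg_space_support: "\<lbrakk>p \<in> sg_space G; H \<notin> fin_index_subgroups G\<rbrakk> \<Longrightarrow> p H = 0"
  by (erule sg_space_cases) (auto simp: sg_vertex_def sg_edge_def sg_adj_def, (metis)+)

lemma sg_action_apply:
  "\<lbrakk>p \<in> sg_space G; g \<in> carrier G; A \<in> fin_index_subgroups G\<rbrakk>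
     \<Longrightarrow> sg_action G g p (conj_set G g A) = p A"
  by (simp add: sg_action_def conj_set_fin_index fin_index_subset)

lemma conj_set_eq_iff:
  assumes "g \<in> carrier G" "A \<in> fin_index_subgroups G" "H \<in> fin_index_subgroups G"
  shows "conj_set G (inv g) H = A \<longleftrightarrow> H = conj_set G g A"
  using conj_set_inv[OF assms(1) fin_index_subset[OF assms(2)]]
    conj_set_inv[OF assms(1) fin_index_subset[OF assms(3)]] by auto

lemma sg_action_vertex:
  assumes g: "g \<in> carrier G" and A: "A \<in> fin_index_subgroups G"
  shows "sg_action G g (sg_vertex A) = sg_vertex (conj_set G g A)"
proof
  show "sg_action G g (sg_vertex A) H = sg_vertex (conj_set G g A) H" for H
    using assms conj_set_fin_index[OF g A] sg_vertex_in_space[OF A]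
    by (auto simp: sg_action_def sg_vertex_def conj_set_eq_iff)
qed

lemma sg_action_edge:
  assumes g: "g \<in> carrier G" and AB: "sg_adj G A B" and p: "p \<in> sg_edge A B"
  shows "sg_action G g p \<in> sg_edge (conj_set G g A) (conj_set G g B)"
proof -
  have sp: "p \<in> sg_space G"
    using AB p by (rule sg_edge_in_space)
  have f: "A \<in> fin_index_subgroups G" "B \<in> fin_index_subgroups G"
    using AB by (auto simp: sg_adj_def)
  have "sg_action G g p H = 0" if "H \<noteq> conj_set G g A" "H \<noteq> conj_set G g B" for H
    using that p sp f g by (auto simp: sg_action_def sg_edge_def conj_set_eq_iff)
  then show ?thesis
    using p sg_action_apply[OF sp g f(1)] sg_action_apply[OF sp g f(2)]
    by (simp add: sg_edge_def)
qed

lemma sg_action_closed: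
  assumes "g \<in> carrier G" "p \<in> sg_space G"
  shows "sg_action G g p \<in> sg_space G"
  using assms(2)
  by (cases rule: sg_space_cases)
     (use assms(1) in \<open>auto simp: sg_action_vertex conj_set_fin_index sg_vertex_in_space
       intro: sg_edge_in_space sg_adj_conj_set sg_action_edge\<close>)

lemma sg_action_mult:
  assumes g: "g \<in> carrier G" and h: "h \<in> carrier G" and p: "p \<in> sg_space G"
  shows "sg_action G (g \<otimes> h) p = sg_action G g (sg_action G h p)"
proof
  show "sg_action G (g \<otimes> h) p H = sg_action G g (sg_action G h p) H" for H
    using assms sg_action_closed[OF h p]
    by (auto simp: sg_action_def inv_mult_group conj_set_mult fin_index_subset conj_set_fin_index)
qed

lemma sg_action_one:
  assumes p: "p \<in> sg_space G"
  shows "sg_action G \<one> p = p"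
proof
  show "sg_action G \<one> p H = p H" for H
    using assms by (auto simp: sg_action_def conj_set_one fin_index_subset sg_space_support)
qed

lemma sg_action_inv:
  assumes "g \<in> carrier G" "p \<in> sg_space G"
  shows "sg_action G (inv g) (sg_action G g p) = p" "sg_action G g (sg_action G (inv g) p) = p"
  using assms by (simp_all flip: sg_action_mult add: sg_action_one)

lemma sg_action_path:
  assumes g: "g \<in> carrier G" and "sg_path G p q l"
  shows "sg_path G (sg_action G g p) (sg_action G g q) l"
  using assms(2)
proof induction
  case (refl p)
  then show ?case
    using g by (simp add: sg_action_closed sg_path.refl)
next
  case (step A B p q r l)
  let ?A = "conj_set G g A" and ?B = "conj_set G g B"
  have "A \<in> fin_index_subgroups G" "p \<in> sg_space G" "q \<in> sg_space G"
    using step by (auto simp: sg_adj_def intro: sg_edge_in_space)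
  then have "sg_action G g p ?A = p A" "sg_action G g q ?A = q A"
    using g by (simp_all add: sg_action_apply)
  moreover have "sg_length G ?A ?B = sg_length G A B"
    using g sg_adj_subset[OF step.hyps(1)] by (simp add: sg_length_conj_set)
  ultimately show ?case
    using sg_path.step[OF sg_adj_conj_set[OF g step.hyps(1)] sg_action_edge[OF g step.hyps(1,2)]
        sg_action_edge[OF g step.hyps(1,3)] step.IH] by simp
qed

lemma sg_action_dist:
  assumes g: "g \<in> carrier G" and p: "p \<in> sg_space G" and q: "q \<in> sg_space G"
  shows "sg_dist G (sg_action G g p) (sg_action G g q) = sg_dist G p q"
proof -
  have "sg_path G (sg_action G g p) (sg_action G g q) l \<longleftrightarrow> sg_path G p q l" for l
    using sg_action_path[OF g, of p q l] sg_action_inv(1)[OF g]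
      sg_action_path[OF inv_closed[OF g], of "sg_action G g p" "sg_action G g q" l] p q by auto
  then have "{l. sg_path G (sg_action G g p) (sg_action G g q) l} = {l. sg_path G p q l}"
    by blast
  then show ?thesis
    using assms by (simp only: sg_dist_def sg_action_closed)
qed

lemma sg_action_extensional: "sg_action G g \<in> extensional (sg_space G)"
  by (simp add: sg_action_def)

lemma sg_action_Bij: "g \<in> carrier G \<Longrightarrow> sg_action G g \<in> Bij (sg_space G)"
  unfolding Bij_def
  by (auto simp: sg_action_closed sg_action_inv sg_action_extensional
      intro!: bij_betw_byWitness[where f' = "sg_action G (inv g)"])

theorem sg_action_isometric: "sg_action G \<in> hom G (IsomGroup (sg_space G) (sg_dist G))"
proof (rule homI)
  show "sg_action G g \<in> carrier (IsomGroup (sg_space G) (sg_dist G))" if "g \<in> carrier G" for g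
    using that by (simp add: IsomGroup_def sg_action_Bij sg_action_dist)
  show "sg_action G (g \<otimes> h) =
      sg_action G g \<otimes>\<^bsub>IsomGroup (sg_space G) (sg_dist G)\<^esub> sg_action G h"
    if "g \<in> carrier G" "h \<in> carrier G" for g h
  proof
    show "sg_action G (g \<otimes> h) p =
        (sg_action G g \<otimes>\<^bsub>IsomGroup (sg_space G) (sg_dist G)\<^esub> sg_action G h) p" for p
      using that sg_action_mult[OF that, of p]
      by (cases "p \<in> sg_space G")
         (simp_all add: IsomGroup_def BijGroup_def sg_action_Bij compose_def
           extensional_arb[OF sg_action_extensional])
  qed
qed

theorem sg_action_group_action: "group_action G (sg_space G) (sg_action G)"
proof -
  have "sg_action G \<in> hom G (BijGroup (sg_space G))"
    using sg_action_isometric by (auto simp: hom_def IsomGroup_def BijGroup_def sg_action_Bij)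
  then show ?thesis
    by (simp add: group_action_def group_hom_def group_hom_axioms_def is_group group_BijGroup)
qed

lemma sg_length_commute: "sg_length G A B = sg_length G B A"
  by (simp add: sg_length_def Int_commute mult.commute)

lemma sg_length_ge_ln2:
  assumes "sg_adj G A B"
  shows "ln 2 \<le> sg_length G A B"
proof -
  have *: "ln 2 \<le> sg_length G A B"
    if m: "maximal_subgroup G A B" and A: "A \<in> fin_index_subgroups G" for A B
  proof -
    have sA: "subgroup A G" and sB: "subgroup B G" and "A \<subset> B"
      using m by (auto simp: maximal_subgroup_def)
    then obtain b where b: "b \<in> B" "b \<notin> A" "b \<in> carrier G"
      using subgroup.subset by blast
    have [simp]: "A \<inter> B = A"
      using \<open>A \<subset> B\<close> by auto
    have "\<And>x. x \<in> A \<Longrightarrow> A #> x = A"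
      using sA by (simp add: coset_join2 subgroup.mem_carrier)
    then have "rcosets\<^bsub>G\<lparr>carrier := A\<rparr>\<^esub> A = {A}"
      using subgroup.one_closed[OF sA] by (auto simp: RCOSETS_def r_coset_def)
    then have 1: "index_in G A A = 1"
      by (simp add: index_in_def)
    let ?R = "rcosets\<^bsub>G\<lparr>carrier := B\<rparr>\<^esub> A"
    have "?R \<subseteq> rcosets A"
      using subgroup.subset[OF sB] by (auto simp: RCOSETS_def r_coset_def)
    then have fin: "finite ?R"
      using A finite_subset by (auto simp: fin_index_subgroups_def)
    have "A #> \<one> \<in> ?R" "A #> b \<in> ?R"
      using subgroup.one_closed[OF sB] b by (auto simp: RCOSETS_def r_coset_def)
    moreover have "A #> \<one> \<noteq> A #> b"
      using b sA subgroup.subset[OF sA] rcos_self[OF b(3) sA] by auto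
    ultimately have "card {A #> \<one>, A #> b} \<le> card ?R" "card {A #> \<one>, A #> b} = 2"
      using card_mono[OF fin, of "{A #> \<one>, A #> b}"] by simp_all
    then have "2 \<le> index_in G B A"
      by (simp add: index_in_def)
    then show ?thesis
      by (simp add: sg_length_def 1)
  qed
  show ?thesis
    using assms *[of A B] *[of B A] sg_length_commute[of A B] by (auto simp: sg_adj_def)
qed

lemma sg_edge_commute: "sg_edge A B = sg_edge B A"
  by (auto simp: sg_edge_def add.commute)

lemma sg_path_space: "sg_path G p q l \<Longrightarrow> p \<in> sg_space G \<and> q \<in> sg_space G"
  by (induction rule: sg_path.induct) (auto intro: sg_edge_in_space)

lemma sg_path_trans: "\<lbrakk>sg_path G p q l; sg_path G q r m\<rbrakk> \<Longrightarrow> sg_path G p r (l + m)"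
proof (induction rule: sg_path.induct)
  case (step A B p q r' l)
  then show ?case
    using sg_path.step[OF step.hyps(1-3), of r "l + m"] by (simp add: add.assoc)
qed auto

lemma sg_path_edge:
  assumes "sg_adj G A B" "p \<in> sg_edge A B" "q \<in> sg_edge A B"
  shows "sg_path G p q (sg_length G A B * \<bar>p A - q A\<bar>)"
  using sg_path.step[OF assms sg_path.refl] sg_edge_in_space assms by fastforce

lemma sg_path_sym: "sg_path G p q l \<Longrightarrow> sg_path G q p l"
proof (induction rule: sg_path.induct)
  case (step A B p q r l)
  show ?case
    using sg_path_trans[OF step.IH sg_path_edge[OF step.hyps(1,3,2)]]
    by (simp add: abs_minus_commute add.commute)
qed (simp add: sg_path.refl)

lemma sg_path_lower: "sg_path G p q l \<Longrightarrow> ln 2 * \<bar>p H - q H\<bar> \<le> l"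
proof (induction rule: sg_path.induct)
  case (step A B p q r l)
  have "\<bar>p H - q H\<bar> \<le> \<bar>p A - q A\<bar>"
    using step.hyps(2,3) unfolding sg_edge_def by (cases "H = A"; cases "H = B") auto
  moreover have "0 \<le> sg_length G A B"
    using order_trans[OF _ sg_length_ge_ln2[OF step.hyps(1)], of 0] by simp
  ultimately have "ln 2 * \<bar>p H - q H\<bar> \<le> sg_length G A B * \<bar>p A - q A\<bar>"
    using sg_length_ge_ln2[OF step.hyps(1)] by (intro mult_mono) auto
  moreover have "ln 2 * \<bar>p H - r H\<bar> \<le> ln 2 * \<bar>p H - q H\<bar> + ln 2 * \<bar>q H - r H\<bar>"
    by (simp flip: distrib_left)
  ultimately show ?case
    using step.IH by linarith
qed simp

lemma finite_supergroups:
  assumes H: "H \<in> fin_index_subgroups G"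
  shows "finite {K. subgroup K G \<and> H \<subseteq> K}"
proof (rule finite_subset)
  show "finite (Union ` Pow (rcosets H))"
    using H by (simp add: fin_index_subgroups_def)
  have sH: "subgroup H G"
    using H by (simp add: fin_index_subgroups_def)
  show "{K. subgroup K G \<and> H \<subseteq> K} \<subseteq> Union ` Pow (rcosets H)"
  proof clarify
    fix K assume K: "subgroup K G" "H \<subseteq> K"
    have "K = \<Union>{H #> k | k. k \<in> K}"
    proof
      show "K \<subseteq> \<Union>{H #> k | k. k \<in> K}"
        using rcos_self[OF _ sH] subgroup.mem_carrier[OF K(1)] by blast
      show "\<Union>{H #> k | k. k \<in> K} \<subseteq> K"
        using K by (auto simp: r_coset_def subgroup.m_closed subset_iff)
    qed
    moreover have "{H #> k | k. k \<in> K} \<in> Pow (rcosets H)"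
      using subgroup.subset[OF K(1)] by (auto simp: RCOSETS_def)
    ultimately show "K \<in> Union ` Pow (rcosets H)"
      by blast
  qed
qed

lemma fin_index_supergroup:
  assumes H: "H \<in> fin_index_subgroups G" and K: "subgroup K G" "H \<subseteq> K"
  shows "K \<in> fin_index_subgroups G"
proof -
  have HG: "H \<subseteq> carrier G" and KG: "K \<subseteq> carrier G"
    using fin_index_subset[OF H] subgroup.subset[OF K(1)] by auto
  have "K <#> H = K"
    using K subgroup.one_closed[of H G] H KG
    by (force simp: set_mult_def fin_index_subgroups_def subgroup.m_closed subset_iff)
  then have "K #> x = K <#> (H #> x)" if "x \<in> carrier G" for x
    using that HG KG by (simp add: setmult_rcos_assoc)
  then have "rcosets K \<subseteq> (\<lambda>C. K <#> C) ` (rcosets H)"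
    by (auto simp: RCOSETS_def)
  then show ?thesis
    using H K(1) finite_surj by (auto simp: fin_index_subgroups_def)
qed

lemma vertex_in_edge: "A \<noteq> B \<Longrightarrow> sg_vertex A \<in> sg_edge A B \<and> sg_vertex B \<in> sg_edge A B"
  by (auto simp: sg_vertex_def sg_edge_def)

lemma sg_path_to_top:
  assumes "H \<in> fin_index_subgroups G"
  shows "\<exists>l. sg_path G (sg_vertex H) (sg_vertex (carrier G)) l"
  using assms
proof (induction "card {K. subgroup K G \<and> H \<subseteq> K}" arbitrary: H rule: less_induct)
  case less
  let ?F = "\<lambda>H. {K. subgroup K G \<and> H \<subseteq> K}"
  have fin: "finite (?F H)"
    using less.prems by (rule finite_supergroups)
  have sH: "subgroup H G"
    using less.prems by (simp add: fin_index_subgroups_def)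
  show ?case
  proof (cases "H = carrier G")
    case True
    then show ?thesis
      using less.prems sg_path.refl sg_vertex_in_space by metis
  next
    case False
    then have "carrier G \<in> ?F H - {H}"
      using subgroup_self fin_index_subset[OF less.prems] by auto
    then obtain K where K: "K \<in> ?F H - {H}" "\<And>L. L \<in> ?F H - {H} \<Longrightarrow> L \<subseteq> K \<Longrightarrow> K = L"
      using finite_has_minimal[of "?F H - {H}"] fin by (metis (lifting) empty_iff finite_Diff)
    then have max: "maximal_subgroup G H K"
      unfolding maximal_subgroup_def using sH by blast
    have Kf: "K \<in> fin_index_subgroups G"
      using fin_index_supergroup less.prems K(1) by auto
    have adj: "sg_adj G H K"
      using max Kf less.prems by (simp add: sg_adj_def)
    have "?F K \<subset> ?F H"
      using K(1) sH by auto
    then have "card (?F K) < card (?F H)"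
      using fin by (rule psubset_card_mono[rotated])
    then obtain l where "sg_path G (sg_vertex K) (sg_vertex (carrier G)) l"
      using less.hyps Kf by blast
    moreover have "sg_vertex H \<in> sg_edge H K" "sg_vertex K \<in> sg_edge H K"
      using K(1) vertex_in_edge[of H K] by auto
    ultimately show ?thesis
      using sg_path.step[OF adj] by blast
  qed
qed

lemma sg_path_exists:
  assumes "p \<in> sg_space G" "q \<in> sg_space G"
  shows "\<exists>l. sg_path G p q l"
proof -
  have top: "\<exists>l. sg_path G p (sg_vertex (carrier G)) l" if "p \<in> sg_space G" for p
    using that
  proof (cases rule: sg_space_cases)
    case (1 A)
    then show ?thesis
      by (simp add: sg_path_to_top)
  next
    case (2 A B)
    have "A \<noteq> B"
      using 2(1) by (auto simp: sg_adj_def maximal_subgroup_def)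
    then have v: "sg_vertex A \<in> sg_edge A B"
      by (simp add: vertex_in_edge)
    have "A \<in> fin_index_subgroups G"
      using 2(1) by (simp add: sg_adj_def)
    then show ?thesis
      using sg_path.step[OF 2 v] sg_path_to_top[of A] by blast
  qed
  show ?thesis
    using top[OF assms(1)] top[OF assms(2)] sg_path_sym sg_path_trans by blast
qed

lemma sg_path_nonneg: "sg_path G p q l \<Longrightarrow> 0 \<le> l"
  using sg_path_lower[of p q l "{}"] by (smt (verit) ln_ge_zero mult_nonneg_nonneg abs_ge_zero)

lemma sg_dist_le: "sg_path G p q l \<Longrightarrow> sg_dist G p q \<le> l"
  using sg_path_space unfolding sg_dist_def
  by (auto intro!: cInf_lower bdd_belowI[where m = 0] sg_path_nonneg)

lemma sg_dist_ge:
  assumes "p \<in> sg_space G" "q \<in> sg_space G" "\<And>l. sg_path G p q l \<Longrightarrow> m \<le> l"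
  shows "m \<le> sg_dist G p q"
  using assms sg_path_exists[OF assms(1,2)] by (auto simp: sg_dist_def intro!: cInf_greatest)

theorem sg_dist_Metric_space: "Metric_space (sg_space G) (sg_dist G)"
proof
  fix p q r
  show "0 \<le> sg_dist G p q"
    by (cases "p \<in> sg_space G \<and> q \<in> sg_space G")
       (auto simp: sg_path_nonneg sg_dist_def intro!: sg_dist_ge[unfolded sg_dist_def]
         cInf_greatest dest: sg_path_exists)
  have "sg_path G p q = sg_path G q p"
    using sg_path_sym by blast
  then show "sg_dist G p q = sg_dist G q p"
    by (simp add: sg_dist_def)
  assume p: "p \<in> sg_space G" and q: "q \<in> sg_space G"
  have lower: "ln 2 * \<bar>p H - q H\<bar> \<le> sg_dist G p q" for H
    using p q sg_path_lower by (rule sg_dist_ge)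
  show "sg_dist G p q = 0 \<longleftrightarrow> p = q"
  proof
    assume "sg_dist G p q = 0"
    then have "ln 2 * \<bar>p H - q H\<bar> \<le> 0" for H
      using lower by metis
    then show "p = q"
      by (auto simp: mult_le_0_iff)
  next
    assume "p = q"
    then show "sg_dist G p q = 0"
      using sg_dist_le[OF sg_path.refl[OF p]] lower[of "{}"] by simp
  qed
  assume r: "r \<in> sg_space G"
  have "sg_dist G p r - m \<le> sg_dist G p q" if m: "sg_path G q r m" for m
    using p q by (rule sg_dist_ge) (use sg_dist_le sg_path_trans m in fastforce)
  then have "sg_dist G p r - sg_dist G p q \<le> sg_dist G q r"
    using q r by (intro sg_dist_ge) (auto simp: algebra_simps)
  then show "sg_dist G p r \<le> sg_dist G p q + sg_dist G q r"
    by simp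
qed

end

end

theory Submission
  imports Defs "HOL-Algebra.Multiplicative_Group"
begin

text \<open>
  Write \<open>[a, b] = a b a\<inverse> b\<inverse>\<close>. The heart of the matter is Schenkman's theorem that in a finite group
  the norm (the set of elements normalising every subgroup) lies in the second centre; the residually
  finite case follows by applying it to the quotients by normal subgroups of finite index.

  Let \<open>a\<close> be in the norm, \<open>z = [a, x] \<in> \<langle>x\<rangle>\<close>, \<open>w = [a, y] \<in> \<langle>y\<rangle>\<close> and \<open>t = [z, y]\<close>. That
  \<open>[a, x y] = z [x, w] w\<close> commutes with \<open>x y\<close> forces \<open>t = [x, w] \<in> \<langle>x\<rangle> \<inter> \<langle>y\<rangle>\<close>, so \<open>t\<close> commutes with
  \<open>x\<close> and \<open>y\<close>. Also \<open>[z, w] = 1\<close>, because two elements of the norm act on \<open>\<langle>y\<rangle>\<close> by powers. Among the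
  pairs with \<open>t \<noteq> 1\<close> choose one for which the sum of the orders of \<open>z\<close> and \<open>w\<close> is least. Passing to
  \<open>x\<^sup>q\<close> or \<open>y\<^sup>q\<close> shows that \<open>z\<close> and \<open>w\<close> have orders that are powers of a single prime \<open>p\<close> and that
  \<open>t\<close> has order \<open>p\<close>. If the order of \<open>z\<close> is the smaller one, some \<open>x' = x y\<^sup>s\<close> has
  \<open>[a, x'] = z w\<^sup>s t\<^sup>s\<close> of smaller order and \<open>[[a, x'], y] = t\<close>, a contradiction.
\<close>

section \<open>Commutators and cyclic subgroups\<close>

definition commutator :: "('a, 'b) monoid_scheme \<Rightarrow> 'a \<Rightarrow> 'a \<Rightarrow> 'a" where
  "commutator G a b = a \<otimes>\<^bsub>G\<^esub> b \<otimes>\<^bsub>G\<^esub> inv\<^bsub>G\<^esub> a \<otimes>\<^bsub>G\<^esub> inv\<^bsub>G\<^esub> b"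

text \<open>Baer's norm of the group. Equality instead of inclusion makes closure under inverses
  immediate.\<close>

definition norm_subgroup :: "('a, 'b) monoid_scheme \<Rightarrow> 'a set" where
  "norm_subgroup G = {a \<in> carrier G. \<forall>H. subgroup H G \<longrightarrow> conj_set G a H = H}"

lemma prime_power_if_unique_prime_divisor:
  assumes "n \<noteq> 0" and "prime p" and "\<And>q::nat. prime q \<Longrightarrow> q dvd n \<Longrightarrow> q = p"
  shows "\<exists>c. n = p ^ c"
proof -
  obtain m where m: "n = p ^ multiplicity p n * m" "\<not> p dvd m"
    using assms by (metis multiplicity_decompose' not_prime_unit)
  have "m = 1"
    using assms(3) m by (metis dvd_mult prime_factor_nat)
  then show ?thesis
    using m by auto
qed

context group
begin

text \<open>In a right-nested product a factor and its inverse can be adjacent without forming a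
  subterm; these rules cancel them there.\<close>

lemma inv_cancel:
  assumes "a \<in> carrier G" "b \<in> carrier G"
  shows "inv a \<otimes> (a \<otimes> b) = b" "a \<otimes> (inv a \<otimes> b) = b"
  using assms by (simp_all flip: m_assoc)

lemmas word_simps = m_assoc inv_mult_group inv_cancel

lemma commutator_closed [simp]:
  "\<lbrakk>a \<in> carrier G; b \<in> carrier G\<rbrakk> \<Longrightarrow> commutator G a b \<in> carrier G"
  by (simp add: commutator_def)

lemma commutator_eq_iff:
  assumes "a \<in> carrier G" "b \<in> carrier G" "c \<in> carrier G"
  shows "commutator G a b = c \<longleftrightarrow> a \<otimes> b = c \<otimes> (b \<otimes> a)"
proof -
  have "commutator G a b = (a \<otimes> b) \<otimes> inv (b \<otimes> a)"
    using assms by (simp add: commutator_def word_simps)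
  then show ?thesis
    using assms inv_solve_right'[of c "a \<otimes> b" "b \<otimes> a"] by simp
qed

lemma commutator_eq_one_iff:
  "\<lbrakk>a \<in> carrier G; b \<in> carrier G\<rbrakk> \<Longrightarrow> commutator G a b = \<one> \<longleftrightarrow> a \<otimes> b = b \<otimes> a"
  by (simp add: commutator_eq_iff)

lemma inv_commutator:
  "\<lbrakk>a \<in> carrier G; b \<in> carrier G\<rbrakk> \<Longrightarrow> inv (commutator G a b) = commutator G b a"
  by (simp add: commutator_def word_simps)

lemma conj_int_pow:
  assumes "a \<in> carrier G" "x \<in> carrier G"
  shows "a \<otimes> x [^] (k::int) \<otimes> inv a = (a \<otimes> x \<otimes> inv a) [^] k"
proof -
  have "(\<lambda>x. a \<otimes> x \<otimes> inv a) \<in> hom G G"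
    using assms by (auto simp: hom_def word_simps)
  then show ?thesis
    using hom_int_pow[of "\<lambda>x. a \<otimes> x \<otimes> inv a" G G x k] assms is_group by simp
qed

lemma int_pow_commute:
  assumes "x \<in> carrier G" "a \<in> carrier G" "a \<otimes> x = x \<otimes> a"
  shows "a \<otimes> x [^] (k::int) = x [^] k \<otimes> a"
proof -
  have "a \<otimes> x [^] k \<otimes> inv a = x [^] k"
    using assms by (simp only: conj_int_pow) (simp add: m_assoc)
  then show ?thesis
    using assms by (simp add: inv_solve_right')
qed

lemma cyclic_subgroup: "x \<in> carrier G \<Longrightarrow> subgroup (generate G {x}) G"
  by (simp add: generate_is_subgroup)

lemma cyclic_self: "x \<in> generate G {x}"
  by (simp add: generate.incl)

lemma cyclic_memE:
  assumes "y \<in> generate G {x}" "x \<in> carrier G"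
  obtains k :: int where "y = x [^] k"
  using assms by (auto simp: generate_pow)

lemma cyclic_commute:
  assumes "y \<in> generate G {x}" "x \<in> carrier G" "a \<in> carrier G" "a \<otimes> x = x \<otimes> a"
  shows "a \<otimes> y = y \<otimes> a"
  using assms int_pow_commute by (metis cyclic_memE)

end

section \<open>The norm of a group\<close>

context group
begin

lemma subgroup_norm_subgroup: "subgroup (norm_subgroup G) G"
proof (rule subgroupI)
  show "norm_subgroup G \<noteq> {}"
    using conj_set_one by (auto simp: norm_subgroup_def subgroup.subset)
  show "inv a \<in> norm_subgroup G" if a: "a \<in> norm_subgroup G" for a
  proof -
    have "conj_set G (inv a) H = H" if H: "subgroup H G" for H
      using conj_set_inv(1)[OF _ subgroup.subset[OF H], of a] a H by (simp add: norm_subgroup_def)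
    then show ?thesis
      using a by (simp add: norm_subgroup_def)
  qed
  show "a \<otimes> b \<in> norm_subgroup G" if "a \<in> norm_subgroup G" "b \<in> norm_subgroup G" for a b
    using that by (auto simp: norm_subgroup_def conj_set_mult subgroup.subset)
qed (auto simp: norm_subgroup_def)

text \<open>The conjugate of \<open>a\<close> by \<open>x\<close> fixes \<open>H\<close> because
  \<open>a\<close> fixes the subgroup \<open>x^-1 H x\<close>.\<close>

lemma normal_norm_subgroup: "norm_subgroup G \<lhd> G"
  unfolding normal_inv_iff
proof (intro conjI ballI subgroup_norm_subgroup)
  fix x a assume x: "x \<in> carrier G" and a: "a \<in> norm_subgroup G"
  have "conj_set G (x \<otimes> a \<otimes> inv x) H = H" if H: "subgroup H G" for H
  proof -
    have "conj_set G (inv x) H \<subseteq> carrier G" "subgroup (conj_set G (inv x) H) G"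
      using x H by (simp_all add: conj_set_subgroup conj_set_subset subgroup.subset)
    then show ?thesis
      using x a H by (simp add: norm_subgroup_def conj_set_mult conj_set_subset subgroup.subset)
  qed
  then show "x \<otimes> a \<otimes> inv x \<in> norm_subgroup G"
    using x a by (simp add: norm_subgroup_def)
qed

lemma norm_carrier: "a \<in> norm_subgroup G \<Longrightarrow> a \<in> carrier G"
  by (simp add: norm_subgroup_def)

lemma norm_commutator:
  assumes a: "a \<in> norm_subgroup G" and x: "x \<in> carrier G"
  shows "commutator G a x \<in> norm_subgroup G" "commutator G x a \<in> norm_subgroup G"
proof -
  interpret N: normal "norm_subgroup G" G
    by (rule normal_norm_subgroup)
  have "commutator G a x = a \<otimes> (x \<otimes> inv a \<otimes> inv x)"
    using x norm_carrier[OF a] by (simp add: commutator_def word_simps)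
  then show *: "commutator G a x \<in> norm_subgroup G"
    using a x N.inv_op_closed2 by simp
  then show "commutator G x a \<in> norm_subgroup G"
    using N.m_inv_closed[OF *] x norm_carrier[OF a] by (simp add: inv_commutator)
qed

lemma norm_conj_mem:
  assumes "a \<in> norm_subgroup G" "subgroup H G" "h \<in> H"
  shows "a \<otimes> h \<otimes> inv a \<in> H"
  using assms by (auto simp: norm_subgroup_def conj_set_image)

text \<open>[a, h] is the product of \<open>a h a^-1\<close> and \<open>h^-1\<close>. Applied to the
  cyclic subgroup of \<open>x\<close> this makes [a, x] a power of \<open>x\<close>.\<close>

lemma norm_commutator_mem:
  assumes a: "a \<in> norm_subgroup G" and H: "subgroup H G" and h: "h \<in> H"
  shows "commutator G a h \<in> H" "commutator G h a \<in> H"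
proof -
  have h': "h \<in> carrier G"
    using H h by (rule subgroup.mem_carrier)
  show *: "commutator G a h \<in> H"
    using norm_conj_mem[OF assms] H h unfolding commutator_def
    by (simp add: subgroup.m_closed subgroup.m_inv_closed)
  show "commutator G h a \<in> H"
    using subgroup.m_inv_closed[OF H *] h' norm_carrier[OF a] by (simp add: inv_commutator)
qed

text \<open>This symmetry lets the descent below treat t as a power of either \<open>x\<close> or
  \<open>y\<close> and exchange their roles.\<close>

lemma norm_commutator_swap:
  assumes a: "a \<in> norm_subgroup G" and x: "x \<in> carrier G" and y: "y \<in> carrier G"
  shows "commutator G (commutator G a x) y = commutator G x (commutator G a y)"
    and "commutator G (commutator G a x) y \<in> generate G {x}"
    and "commutator G (commutator G a x) y \<in> generate G {y}"
proof -
  define z w u where "z = commutator G a x" and "w = commutator G a y" and "u = commutator G x w"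
  have ac: "a \<in> carrier G"
    using a by (rule norm_carrier)
  have zN: "z \<in> norm_subgroup G" and wN: "w \<in> norm_subgroup G"
    using a x y by (simp_all add: z_def w_def norm_commutator)
  have uN: "u \<in> norm_subgroup G"
    using wN x by (simp add: u_def norm_commutator)
  have zx: "z \<in> generate G {x}" and wy: "w \<in> generate G {y}"
    using a x y by (simp_all add: z_def w_def norm_commutator_mem cyclic_subgroup cyclic_self)
  have ux: "u \<in> generate G {x}"
    using wN x by (simp add: u_def norm_commutator_mem cyclic_subgroup cyclic_self)
  note [simp] = ac x y norm_carrier[OF zN] norm_carrier[OF wN] norm_carrier[OF uN]
  \<comment> \<open>\<open>v\<close> collects the powers of \<open>x\<close> in [a, x y] = v w, so
    \<open>x\<close> commutes with \<open>v\<close> and \<open>y\<close> with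
    \<open>w\<close>.\<close>
  define v where "v = z \<otimes> u"
  have vN: "v \<in> norm_subgroup G"
    using zN uN subgroup_norm_subgroup by (simp add: v_def subgroup.m_closed)
  note [simp] = norm_carrier[OF vN]
  have vx: "x \<otimes> v = v \<otimes> x"
    using subgroup.m_closed[OF cyclic_subgroup[OF x] zx ux] unfolding v_def
    by (rule cyclic_commute[OF _ x x HOL.refl])
  \<comment> \<open>\<open>e\<close> measures how far \<open>y\<close> is from commuting with
    \<open>v\<close>. As \<open>inv v\<close> is in the norm, \<open>e\<close> is a power of
    \<open>y\<close>.\<close>
  define e where "e = commutator G (inv v) y"
  have ey: "e \<in> generate G {y}"
    using vN subgroup_norm_subgroup unfolding e_def
    by (simp add: norm_commutator_mem cyclic_subgroup cyclic_self subgroup.m_inv_closed)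
  have [simp]: "e \<in> carrier G"
    by (simp add: e_def)
  have xw: "x \<otimes> w = u \<otimes> (w \<otimes> x)"
    using commutator_eq_iff[of x w u] by (simp add: u_def)
  have yw: "y \<otimes> w = w \<otimes> y"
    by (rule cyclic_commute[OF wy y y HOL.refl])
  have yv: "y \<otimes> v = v \<otimes> (e \<otimes> y)"
    by (simp add: e_def commutator_def word_simps)
  have g: "commutator G a (x \<otimes> y) = v \<otimes> w"
  proof -
    have "commutator G a (x \<otimes> y) = z \<otimes> (x \<otimes> w) \<otimes> inv x"
      by (simp add: z_def w_def commutator_def word_simps)
    then show ?thesis
      by (simp add: xw v_def word_simps)
  qed
  \<comment> \<open>[a, x y] is a power of x y, hence commutes with it.\<close>
  have "(x \<otimes> y) \<otimes> (v \<otimes> w) = (v \<otimes> w) \<otimes> (x \<otimes> y)"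
    using norm_commutator_mem(1)[OF a cyclic_subgroup cyclic_self, of "x \<otimes> y"] unfolding g
    by (rule cyclic_commute[OF _ _ _ HOL.refl]) simp_all
  moreover have "(x \<otimes> y) \<otimes> (v \<otimes> w) = v \<otimes> (x \<otimes> (e \<otimes> (w \<otimes> y)))"
  proof -
    have "(x \<otimes> y) \<otimes> (v \<otimes> w) = x \<otimes> (y \<otimes> v) \<otimes> w"
      by (simp add: m_assoc)
    also have "\<dots> = (x \<otimes> v) \<otimes> (e \<otimes> (y \<otimes> w))"
      by (simp only: yv) (simp add: m_assoc)
    finally show ?thesis
      by (simp only: vx yw) (simp add: m_assoc)
  qed
  ultimately have "x \<otimes> (e \<otimes> w) \<otimes> y = w \<otimes> x \<otimes> y"
    by (simp add: m_assoc)
  then have "x \<otimes> (e \<otimes> w) = w \<otimes> x"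
    by (subst (asm) right_cancel) auto
  also have "\<dots> = inv u \<otimes> (x \<otimes> w)"
    by (simp add: xw word_simps)
  also have "\<dots> = x \<otimes> (inv u \<otimes> w)"
    using cyclic_commute[OF subgroup.m_inv_closed[OF cyclic_subgroup[OF x] ux] x x HOL.refl]
    by (simp flip: m_assoc)
  \<comment> \<open>A power of \<open>y\<close> equals a power of \<open>x\<close>, so
    \<open>u\<close> lies in both cyclic subgroups.\<close>
  finally have e: "e = inv u"
    by simp
  have uy: "u \<in> generate G {y}"
    using subgroup.m_inv_closed[OF cyclic_subgroup ey] by (simp add: e)
  have uy': "y \<otimes> u = u \<otimes> y"
    by (rule cyclic_commute[OF uy y y HOL.refl])
  have zu: "z \<otimes> u = u \<otimes> z"
    using cyclic_commute[OF ux x _ cyclic_commute[OF zx x x HOL.refl, symmetric]] by simp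
  have "y \<otimes> z \<otimes> u = z \<otimes> y"
    using yv by (simp add: e v_def word_simps)
  then have "z \<otimes> y = u \<otimes> (y \<otimes> z)"
    using zu uy' by (metis m_assoc norm_carrier uN y zN)
  then have "commutator G z y = u"
    by (simp add: commutator_eq_iff)
  then show "commutator G (commutator G a x) y = commutator G x (commutator G a y)"
    "commutator G (commutator G a x) y \<in> generate G {x}"
    "commutator G (commutator G a x) y \<in> generate G {y}"
    using ux uy by (simp_all add: z_def u_def w_def)
qed

section \<open>Power automorphisms and commutators of powers\<close>

lemma commute_mult:
  assumes "c \<otimes> a = a \<otimes> c" "c \<otimes> b = b \<otimes> c" "a \<in> carrier G" "b \<in> carrier G" "c \<in> carrier G"
  shows "c \<otimes> (a \<otimes> b) = (a \<otimes> b) \<otimes> c"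
  using assms by (metis m_assoc)

lemma norm_conj_int_pow:
  assumes a: "a \<in> norm_subgroup G" and y: "y \<in> carrier G"
  obtains n :: int where "a \<otimes> y \<otimes> inv a = y [^] n"
  using norm_conj_mem[OF a cyclic_subgroup cyclic_self] y by (metis cyclic_memE)

text \<open>Both \<open>a\<close> and \<open>b\<close> send each element to one of its powers, and
  power maps on a cyclic group commute. So a b and b a induce the same conjugation.\<close>

lemma norm_commutator_central:
  assumes a: "a \<in> norm_subgroup G" and b: "b \<in> norm_subgroup G" and y: "y \<in> carrier G"
  shows "commutator G (commutator G a b) y = \<one>"
proof -
  note [simp] = norm_carrier[OF a] norm_carrier[OF b] y
  have *: "(a \<otimes> b) \<otimes> v \<otimes> inv (a \<otimes> b) = (b \<otimes> a) \<otimes> v \<otimes> inv (b \<otimes> a)"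
    if v[simp]: "v \<in> carrier G" for v
  proof -
    obtain n :: int where n: "a \<otimes> v \<otimes> inv a = v [^] n"
      by (rule norm_conj_int_pow[OF a v])
    obtain m :: int where m: "b \<otimes> v \<otimes> inv b = v [^] m"
      by (rule norm_conj_int_pow[OF b v])
    have "(a \<otimes> b) \<otimes> v \<otimes> inv (a \<otimes> b) = a \<otimes> (b \<otimes> v \<otimes> inv b) \<otimes> inv a"
      by (simp add: word_simps)
    also have "\<dots> = v [^] (n * m)"
      by (simp add: n m conj_int_pow int_pow_pow)
    also have "\<dots> = b \<otimes> (a \<otimes> v \<otimes> inv a) \<otimes> inv b"
      by (simp add: n m conj_int_pow int_pow_pow mult.commute)
    finally show ?thesis
      by (simp add: word_simps)
  qed
  \<comment> \<open>The element inserted for \<open>v\<close> is the one that conjugation by b a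
    sends to \<open>y\<close>.\<close>
  have "(a \<otimes> b) \<otimes> (inv (b \<otimes> a) \<otimes> y \<otimes> (b \<otimes> a)) \<otimes> inv (a \<otimes> b) = y"
    by (subst *) (simp_all add: word_simps)
  then have "commutator G a b \<otimes> y \<otimes> inv (commutator G a b) = y"
    by (simp add: commutator_def word_simps)
  then show ?thesis
    by (simp add: commutator_def)
qed

text \<open>Conjugation by \<open>a\<close> sends \<open>x\<close> to [a, x] x, whose factors
  commute, so the power distributes.\<close>

lemma commutator_int_pow_right:
  assumes "a \<in> carrier G" "x \<in> carrier G" "commutator G a x \<otimes> x = x \<otimes> commutator G a x"
  shows "commutator G a (x [^] (k::int)) = commutator G a x [^] k"
proof -
  have "a \<otimes> x \<otimes> inv a = commutator G a x \<otimes> x"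
    using assms(1,2) by (simp add: commutator_def word_simps)
  then have "a \<otimes> x [^] k \<otimes> inv a = commutator G a x [^] k \<otimes> x [^] k"
    using assms int_pow_mult_distrib[OF assms(3), of k] by (simp only: conj_int_pow commutator_closed)
  then show ?thesis
    using assms unfolding commutator_def[of G a "x [^] k"] by (simp add: m_assoc)
qed

lemma commutator_int_pow_left:
  assumes "a \<in> carrier G" "x \<in> carrier G" "commutator G x a \<otimes> x = x \<otimes> commutator G x a"
  shows "commutator G (x [^] (k::int)) a = commutator G x a [^] k"
proof -
  have "commutator G a x \<otimes> x = x \<otimes> commutator G a x"
    using assms by (metis commutator_closed inv_commutator inv_solve_left inv_solve_right m_assoc m_closed)
  then have "inv (commutator G a (x [^] k)) = inv (commutator G a x [^] k)"
    using assms by (simp add: commutator_int_pow_right)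
  then show ?thesis
    using assms by (simp add: inv_commutator flip: int_pow_inv)
qed

text \<open>A cyclic group has at most one subgroup of order p, and \<open>h\<close> generates it.
  Exponents are compared modulo \<open>ord x\<close>; the value 0 for infinite order fits, since 0
  divides only 0.\<close>

lemma prime_order_mem_cyclic:
  assumes x: "x \<in> carrier G" and g: "g \<in> generate G {x}" and h: "h \<in> generate G {x}"
    and p: "prime (p::nat)" and gp: "g [^] p = \<one>" and hp: "h [^] p = \<one>" and h1: "h \<noteq> \<one>"
  shows "g \<in> generate G {h}"
proof -
  obtain i j :: int where ij: "g = x [^] i" "h = x [^] j"
    using x g h by (metis cyclic_memE)
  let ?n = "int (ord x)"
  have dvd: "?n dvd i * int p" "?n dvd j * int p"
    using gp hp x by (simp_all add: ij int_pow_pow int_pow_eq_id flip: int_pow_int)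
  have nj: "\<not> ?n dvd j"
    using h1 x by (simp add: ij int_pow_eq_id)
  have "int p dvd ?n"
  proof (rule ccontr)
    assume "\<not> int p dvd ?n"
    then have "coprime ?n (int p)"
      using p by (metis coprime_commute prime_imp_coprime prime_nat_int_transfer)
    then show False
      using dvd(2) nj by (simp add: coprime_dvd_mult_left_iff)
  qed
  then obtain m where m: "?n = int p * m" ..
  have p0: "int p \<noteq> 0"
    using p by auto
  obtain i' j' where ij': "i = m * i'" "j = m * j'"
    using dvd p0 by (auto simp: m mult.commute[of _ "int p"] dvd_def)
  \<comment> \<open>Otherwise \<open>?n\<close> = p m would divide j = m j'. So j' is invertible
    modulo p, and Bezout makes i a multiple of j modulo \<open>?n\<close>.\<close>
  have "\<not> int p dvd j'"
    using nj by (auto simp: m ij')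
  then have "coprime j' (int p)"
    using p by (metis coprime_commute prime_imp_coprime prime_nat_int_transfer)
  then obtain u v where "u * j' + v * int p = 1"
    by (metis bezout_int coprime_imp_gcd_eq_1)
  then have "i = m * i' * (u * j' + v * int p)"
    by (simp add: ij')
  then have "i = j * (u * i') + ?n * (v * i')"
    by (simp add: ij' m algebra_simps)
  then have "g = h [^] (u * i')"
    using x by (simp add: ij int_pow_pow int_pow_eq algebra_simps)
  then show ?thesis
    using h x by (auto simp: generate_pow ij)
qed

text \<open>The minimal pair, when z has the smaller order. Minimality is a hypothesis in each
  variable separately, so that the other case can use the lemma with \<open>x\<close> and
  \<open>y\<close> exchanged.\<close>

lemma norm_commutator_descent:
  assumes a: "a \<in> norm_subgroup G" and x: "x \<in> carrier G" and y: "y \<in> carrier G"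
    and fin: "0 < ord (commutator G a x)"
    and le: "ord (commutator G a x) \<le> ord (commutator G a y)"
    and min_x: "\<And>x'. \<lbrakk>x' \<in> carrier G; ord (commutator G a x') < ord (commutator G a x)\<rbrakk>
      \<Longrightarrow> commutator G (commutator G a x') y = \<one>"
    and min_y: "\<And>y'. \<lbrakk>y' \<in> carrier G; ord (commutator G a y') < ord (commutator G a y)\<rbrakk>
      \<Longrightarrow> commutator G (commutator G a x) y' = \<one>"
  shows "commutator G (commutator G a x) y = \<one>"
proof (rule ccontr)
  define z w t where "z = commutator G a x" and "w = commutator G a y" and "t = commutator G z y"
  assume "commutator G (commutator G a x) y \<noteq> \<one>"
  then have t1: "t \<noteq> \<one>"
    by (simp add: z_def t_def)
  have zN: "z \<in> norm_subgroup G" and wN: "w \<in> norm_subgroup G"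
    using a x y by (simp_all add: z_def w_def norm_commutator)
  have zx: "z \<in> generate G {x}" and wy: "w \<in> generate G {y}"
    using a x y by (simp_all add: z_def w_def norm_commutator_mem cyclic_subgroup cyclic_self)
  note [simp] = norm_carrier[OF a] x y norm_carrier[OF zN] norm_carrier[OF wN]
  have [simp]: "t \<in> carrier G"
    by (simp add: t_def)
  have t_swap: "t = commutator G x w" and tx: "t \<in> generate G {x}" and ty: "t \<in> generate G {y}"
    using norm_commutator_swap[OF a x y] by (simp_all add: z_def w_def t_def)
  have xt: "x \<otimes> t = t \<otimes> x" and yt: "y \<otimes> t = t \<otimes> y"
    using cyclic_commute[OF tx x x HOL.refl] cyclic_commute[OF ty y y HOL.refl] .
  have xz: "x \<otimes> z = z \<otimes> x" and yw: "y \<otimes> w = w \<otimes> y"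
    using cyclic_commute[OF zx x x HOL.refl] cyclic_commute[OF wy y y HOL.refl] .
  have tz: "t \<otimes> z = z \<otimes> t"
    by (rule cyclic_commute[OF zx x _ xt[symmetric]]) simp
  have tw: "t \<otimes> w = w \<otimes> t"
    by (rule cyclic_commute[OF wy y _ yt[symmetric]]) simp
  have zw: "z \<otimes> w = w \<otimes> z"
  proof -
    \<comment> \<open>This is \<open>norm_commutator_swap\<close> with \<open>z\<close> in place of
      \<open>x\<close>.\<close>
    have "commutator G z w = commutator G (commutator G a z) y"
      using norm_commutator_swap(1)[OF a _ y, of z] by (simp add: w_def)
    then show ?thesis
      using norm_commutator_central[OF a zN y] by (simp add: commutator_eq_one_iff)
  qed
  have z_pow: "commutator G a (x [^] k) = z [^] k" and w_pow: "commutator G a (y [^] k) = w [^] k"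
    and t_pow: "commutator G (z [^] k) y = t [^] k" and t_pow': "commutator G z (y [^] k) = t [^] k"
    for k :: int
    unfolding z_def w_def t_def
    using xz yw tz yt
    by (simp_all add: commutator_int_pow_right commutator_int_pow_left flip: z_def w_def t_def)

  have ord_pow_less: "ord (g [^] int q) < ord g"
    if "g \<in> carrier G" "prime q" "q dvd ord g" "0 < ord g" for g q
    using that prime_gt_1_nat[of q] by (simp add: int_pow_int ord_pow)
  \<comment> \<open>[a, x^q] = z^q has smaller order than z, so minimality gives 1 = [z^q, y] =
    t^q.\<close>
  have pow_x: "t [^] q = \<one>" if "prime q" "q dvd ord z" for q
    using min_x[of "x [^] int q"] ord_pow_less[of z q] that fin z_pow[of "int q"] t_pow[of "int q"]
    by (simp add: int_pow_int flip: z_def)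
  have pow_y: "t [^] q = \<one>" if "prime q" "q dvd ord w" for q
    using min_y[of "y [^] int q"] ord_pow_less[of w q] that fin le w_pow[of "int q"] t_pow'[of "int q"]
    by (simp add: int_pow_int flip: z_def w_def)
  have "z \<noteq> \<one>"
    using t1 by (auto simp: t_def commutator_def)
  then obtain p where p: "prime p" "p dvd ord z"
    using ord_eq_1 prime_factor_nat by (metis norm_carrier zN)
  have tp: "t [^] p = \<one>"
    using pow_x p .
  have uniq: "q = p" if "prime q" "t [^] q = \<one>" for q
  proof -
    have "ord t dvd q" "ord t dvd p"
      using that tp by (simp_all flip: pow_eq_id)
    moreover have "ord t \<noteq> 1"
      using ord_eq_1[of t] t1 by simp
    ultimately show ?thesis
      using that(1) p(1) by (metis prime_nat_iff)
  qed
  have fin': "ord z \<noteq> 0" "ord w \<noteq> 0"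
    using fin le by (simp_all flip: z_def w_def)
  obtain c where c: "ord z = p ^ c"
    using prime_power_if_unique_prime_divisor[OF fin'(1) p(1)] pow_x uniq by blast
  obtain d where d: "ord w = p ^ d"
    using prime_power_if_unique_prime_divisor[OF fin'(2) p(1)] pow_y uniq by blast
  have "c \<le> d"
    using le prime_gt_1_nat[OF p(1)] by (simp add: c d power_increasing_iff flip: z_def w_def)
  then obtain k where k: "ord w = ord z * k"
    unfolding c d using le_imp_power_dvd by (metis dvdE)
  obtain m where m: "ord z = p * m"
    using p(2) ..
  have w0: "ord w = p * (m * k)" "0 < ord w"
    using k m le fin by (simp_all add: z_def w_def)
  \<comment> \<open>The exponents are the orders of z and w divided by p, so both elements are
    killed by p.\<close>
  let ?z = "z [^] m" and ?w = "w [^] (m * k)"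
  have zp: "?z [^] p = \<one>" and wp: "?w [^] p = \<one>"
    using m w0 by (simp_all add: nat_pow_pow pow_eq_id mult.commute)
  have w1: "?w \<noteq> \<one>"
    using w0 prime_gt_1_nat[OF p(1)] by (auto simp: pow_eq_id dest: dvd_imp_le)
  have zx': "?z \<in> generate G {x}"
    using subgroup_int_pow_closed[OF cyclic_subgroup[OF x] zx, of "int m"] by (simp add: int_pow_int)
  have wy': "?w \<in> generate G {y}"
    using subgroup_int_pow_closed[OF cyclic_subgroup[OF y] wy, of "int (m * k)"]
    by (simp only: int_pow_int)
  \<comment> \<open>Uniqueness of the subgroup of order p, in the cyclic groups of \<open>x\<close>
    and then \<open>y\<close>, passes from \<open>?z\<close> to \<open>t\<close> and from
    \<open>t\<close> to \<open>?w\<close>.\<close>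
  obtain i :: int where i: "?z = t [^] i"
    using prime_order_mem_cyclic[OF x zx' tx p(1) zp tp t1] by (rule cyclic_memE) simp
  obtain j :: int where j: "t = ?w [^] j"
    using prime_order_mem_cyclic[OF y ty wy' p(1) tp wp w1] by (rule cyclic_memE) simp
  \<comment> \<open>chosen so that \<open>(z w\<^sup>s)\<^sup>m = 1\<close>\<close>
  define s where "s = - (int k * j * i)"
  \<comment> \<open>\<open>?z\<close> is a power of \<open>t\<close>, hence commutes with
    \<open>y\<close>. This removes t^s from the m-th power of \<open>?v\<close>.\<close>
  have "t [^] int m = commutator G ?z y"
    using t_pow[of "int m"] by (simp add: int_pow_int)
  also have "\<dots> = \<one>"
    using int_pow_commute[of t y i] yt by (simp add: i commutator_eq_one_iff)
  finally have tm: "t [^] int m = \<one>" .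
  have z_w: "?z = w [^] (int m * (int k * j * i))"
  proof -
    have "?z = ((w [^] int (m * k)) [^] j) [^] i"
      using i j by (simp only: int_pow_int)
    then show ?thesis
      by (simp add: int_pow_pow mult.assoc)
  qed

  let ?x = "x \<otimes> y [^] s" and ?v = "z \<otimes> (w [^] s \<otimes> t [^] s)"
  have tw': "t [^] s \<otimes> w [^] s = w [^] s \<otimes> t [^] s"
    using int_pow_commute[of w "t [^] s" s] int_pow_commute[of t w s] tw by simp
  have v: "commutator G a ?x = ?v"
  proof -
    \<comment> \<open>Expansion of [a, x c] as [a, x] times the conjugate of [a, c] by
      \<open>x\<close>, with c = y^s.\<close>
    have "commutator G a ?x = z \<otimes> (x \<otimes> commutator G a (y [^] s) \<otimes> inv x)"
      by (simp add: commutator_def z_def word_simps)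
    also have "\<dots> = z \<otimes> (x \<otimes> w \<otimes> inv x) [^] s"
      by (simp add: w_pow conj_int_pow)
    also have "x \<otimes> w \<otimes> inv x = w \<otimes> t"
      using commutator_eq_iff[of x w t] t_swap tw by (simp add: inv_solve_right' m_assoc)
    finally show ?thesis
      using tw by (simp add: int_pow_mult_distrib)
  qed
  have wz': "z \<otimes> (w [^] s \<otimes> t [^] s) = (w [^] s \<otimes> t [^] s) \<otimes> z"
    using zw tz by (intro commute_mult) (simp_all add: int_pow_commute)
  have "?v [^] int m = \<one>"
  proof -
    have "?v [^] int m = z [^] int m \<otimes> (w [^] s \<otimes> t [^] s) [^] int m"
      by (rule int_pow_mult_distrib[OF wz']) simp_all
    also have "(w [^] s \<otimes> t [^] s) [^] int m = (w [^] s) [^] int m \<otimes> (t [^] s) [^] int m"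
      by (rule int_pow_mult_distrib[OF tw'[symmetric]]) simp_all
    also have "(t [^] s) [^] int m = (t [^] int m) [^] s"
      by (simp only: int_pow_pow \<open>t \<in> carrier G\<close> mult.commute)
    also have "\<dots> = \<one>"
      by (simp add: tm)
    also have "(w [^] s) [^] int m = w [^] (- (int m * (int k * j * i)))"
      by (simp add: int_pow_pow s_def mult.commute)
    also have "z [^] int m = w [^] (int m * (int k * j * i))"
      using z_w by (simp only: int_pow_int)
    finally show ?thesis
      by (simp add: int_pow_neg)
  qed
  then have "ord ?v dvd m"
    by (simp add: int_pow_int pow_eq_id)
  moreover have m0: "0 < m"
    using m fin'(1) by (cases m) simp_all
  ultimately have "ord ?v \<le> m"
    by (rule dvd_imp_le)
  also have "m < ord z"
    using m0 prime_gt_1_nat[OF p(1)] by (simp add: m)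
  finally have lt: "ord ?v < ord z" .
  have "commutator G (commutator G a ?x) y = \<one>"
  proof (rule min_x)
    show "ord (commutator G a ?x) < ord (commutator G a x)"
      using lt by (simp only: v z_def[symmetric])
  qed simp
  then have "commutator G ?v y = \<one>"
    by (simp only: v)
  \<comment> \<open>The factor w^s t^s commutes with \<open>y\<close>, so [v, y] = [z, y].\<close>
  moreover have "commutator G ?v y = t"
  proof -
    have "y \<otimes> (w [^] s \<otimes> t [^] s) = (w [^] s \<otimes> t [^] s) \<otimes> y"
      using yw yt by (intro commute_mult) (simp_all add: int_pow_commute)
    then have "?v \<otimes> y = z \<otimes> y \<otimes> (w [^] s \<otimes> t [^] s)"
      by (simp add: m_assoc)
    also have "z \<otimes> y = t \<otimes> (y \<otimes> z)"
      using commutator_eq_iff[of z y t] by (simp add: t_def)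
    finally show ?thesis
      by (simp add: commutator_eq_iff m_assoc)
  qed
  ultimately show False
    using t1 by simp
qed

text \<open>Schenkman's theorem, by induction on a measure symmetric in \<open>x\<close> and
  \<open>y\<close>. Finiteness keeps the orders positive, as \<open>ord\<close> is 0 for infinite
  order.\<close>

theorem norm_commutator_commutator:
  assumes fin: "finite (carrier G)" and a: "a \<in> norm_subgroup G"
    and "x \<in> carrier G" "y \<in> carrier G"
  shows "commutator G (commutator G a x) y = \<one>"
  using assms(3,4)
proof (induction "ord (commutator G a x) + ord (commutator G a y)" arbitrary: x y rule: less_induct)
  case less
  note [simp] = norm_carrier[OF a] less.prems
  have pos: "0 < ord (commutator G a v)" if "v \<in> carrier G" for v
    using that ord_ge_1[OF fin, of "commutator G a v"] by simp
  \<comment> \<open>The first commutator equals [u, [a, v]], which is inverse to the second.\<close>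
  have swap: "commutator G (commutator G a v) u = \<one>"
    if "commutator G (commutator G a u) v = \<one>" "u \<in> carrier G" "v \<in> carrier G" for u v
  proof -
    have "commutator G u (commutator G a v) = \<one>"
      using that norm_commutator_swap(1)[OF a] by metis
    then show ?thesis
      using inv_commutator[of u "commutator G a v"] that by simp
  qed
  show ?case
  proof (cases "ord (commutator G a x) \<le> ord (commutator G a y)")
    case True
    show ?thesis
    proof (rule norm_commutator_descent[OF a less.prems pos[OF less.prems(1)] True])
      show "commutator G (commutator G a x') y = \<one>"
        if "x' \<in> carrier G" "ord (commutator G a x') < ord (commutator G a x)" for x'
        using that less.prems(2) by (intro less.hyps) auto
      show "commutator G (commutator G a x) y' = \<one>"
        if "y' \<in> carrier G" "ord (commutator G a y') < ord (commutator G a y)" for y'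
        using that less.prems(1) by (intro less.hyps) auto
    qed
  next
    case False
    then have le: "ord (commutator G a y) \<le> ord (commutator G a x)"
      by simp
    have "commutator G (commutator G a y) x = \<one>"
    proof (rule norm_commutator_descent[OF a less.prems(2,1) pos[OF less.prems(2)] le])
      show "commutator G (commutator G a y') x = \<one>"
        if "y' \<in> carrier G" "ord (commutator G a y') < ord (commutator G a y)" for y'
      proof (rule swap)
        show "commutator G (commutator G a x) y' = \<one>"
          using that less.prems(1) by (intro less.hyps) auto
      qed (use that less.prems in auto)
      show "commutator G (commutator G a y) x' = \<one>"
        if "x' \<in> carrier G" "ord (commutator G a x') < ord (commutator G a x)" for x'
      proof (rule swap)
        show "commutator G (commutator G a x') y = \<one>"
          using that less.prems(2) by (intro less.hyps) auto
      qed (use that less.prems in auto)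
    qed
    then show ?thesis
      by (rule swap) simp_all
  qed
qed

end

section \<open>Quotients by normal subgroups of finite index\<close>

lemma (in group_hom) hom_commutator:
  "\<lbrakk>a \<in> carrier G; b \<in> carrier G\<rbrakk> \<Longrightarrow> h (commutator G a b) = commutator H (h a) (h b)"
  by (simp add: commutator_def)

lemma (in normal) group_hom_Mod: "group_hom G (G Mod H) (\<lambda>a. H #> a)"
  by (simp add: group_hom_def group_hom_axioms_def factorgroup_is_group r_coset_hom_Mod is_group)

text \<open>The bridge to quotients: it pulls the finite case back to \<open>G\<close> and describes
  the second centre.\<close>

lemma (in normal) commutator_Mod_eq_one_iff:
  assumes "a \<in> carrier G" "b \<in> carrier G"
  shows "commutator (G Mod H) (H #> a) (H #> b) = \<one>\<^bsub>G Mod H\<^esub> \<longleftrightarrow> commutator G a b \<in> H"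
proof -
  interpret Q: group_hom G "G Mod H" "\<lambda>a. H #> a"
    by (rule group_hom_Mod)
  have "commutator (G Mod H) (H #> a) (H #> b) = H #> commutator G a b"
    using assms by (simp add: Q.hom_commutator)
  then show ?thesis
    using assms coset_join1[OF _ _ is_subgroup] coset_join2[OF _ is_subgroup] subset
    by (metis commutator_closed one_FactGroup)
qed

context group
begin

section \<open>Normal cores and finite quotients\<close>

definition normal_core :: "'a set \<Rightarrow> 'a set" where
  "normal_core H = {g \<in> carrier G. \<forall>x \<in> carrier G. x \<otimes> g \<otimes> inv x \<in> H}"

lemma normal_core_subset:
  assumes "subgroup H G"
  shows "normal_core H \<subseteq> H"
proof
  fix g assume g: "g \<in> normal_core H"
  then have "\<one> \<otimes> g \<otimes> inv \<one> \<in> H" "g \<in> carrier G"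
    unfolding normal_core_def by blast+
  then show "g \<in> H"
    by simp
qed

lemma normal_core_normal:
  assumes H: "subgroup H G"
  shows "normal_core H \<lhd> G"
  unfolding normal_inv_iff
proof (intro conjI ballI)
  show "subgroup (normal_core H) G"
  proof (rule subgroupI)
    have "\<one> \<in> normal_core H"
      using H by (simp add: normal_core_def subgroup.one_closed)
    then show "normal_core H \<noteq> {}"
      by blast
    show "inv a \<in> normal_core H" if "a \<in> normal_core H" for a
      unfolding normal_core_def
    proof (intro CollectI conjI ballI)
      show "inv a \<in> carrier G"
        using that by (simp add: normal_core_def)
      fix x assume x: "x \<in> carrier G"
      have "inv (x \<otimes> a \<otimes> inv x) \<in> H"
        using that x subgroup.m_inv_closed[OF H] by (simp add: normal_core_def)
      then show "x \<otimes> inv a \<otimes> inv x \<in> H"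
        using that x by (simp add: normal_core_def word_simps)
    qed
    show "a \<otimes> b \<in> normal_core H" if "a \<in> normal_core H" "b \<in> normal_core H" for a b
      unfolding normal_core_def
    proof (intro CollectI conjI ballI)
      show "a \<otimes> b \<in> carrier G"
        using that by (simp add: normal_core_def)
      fix x assume x: "x \<in> carrier G"
      have "(x \<otimes> a \<otimes> inv x) \<otimes> (x \<otimes> b \<otimes> inv x) \<in> H"
        using that x subgroup.m_closed[OF H] by (simp add: normal_core_def)
      then show "x \<otimes> (a \<otimes> b) \<otimes> inv x \<in> H"
        using that x by (simp add: normal_core_def word_simps)
    qed
  qed (simp add: normal_core_def)
  fix x h assume x: "x \<in> carrier G" and h: "h \<in> normal_core H"
  have "y \<otimes> (x \<otimes> h \<otimes> inv x) \<otimes> inv y \<in> H" if y: "y \<in> carrier G" for y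
  proof -
    have "(y \<otimes> x) \<otimes> h \<otimes> inv (y \<otimes> x) \<in> H"
      using x y h unfolding normal_core_def by blast
    then show ?thesis
      using x y h by (simp add: normal_core_def word_simps)
  qed
  then show "x \<otimes> h \<otimes> inv x \<in> normal_core H"
    using x h by (simp add: normal_core_def)
qed

text \<open>The core is the kernel of the action of \<open>G\<close> by right multiplication on the
  finite set of cosets of \<open>H\<close>.\<close>

lemma finite_rcosets_normal_core:
  assumes H: "H \<in> fin_index_subgroups G"
  shows "finite (rcosets (normal_core H))"
proof -
  have sH: "subgroup H G" and fin: "finite (rcosets H)"
    using H by (simp_all add: fin_index_subgroups_def)
  interpret N: normal "normal_core H" G
    using sH by (rule normal_core_normal)
  \<comment> \<open>Restriction to the cosets of \<open>H\<close> places these maps in a finite set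
    of extensional functions.\<close>
  define \<phi> where "\<phi> g = (\<lambda>C \<in> rcosets H. C #> g)" for g
  have "C #> g \<in> rcosets H" if "C \<in> rcosets H" "g \<in> carrier G" for C g
    using that fin_index_subset[OF H] by (auto simp: RCOSETS_def coset_mult_assoc)
  then have "\<phi> ` carrier G \<subseteq> rcosets H \<rightarrow>\<^sub>E rcosets H"
    by (auto simp: \<phi>_def)
  then have fin_\<phi>: "finite (\<phi> ` carrier G)"
    by (rule finite_subset) (simp add: fin finite_PiE)
  have eq: "normal_core H #> g = normal_core H #> g'"
    if g: "g \<in> carrier G" "g' \<in> carrier G" and "\<phi> g = \<phi> g'" for g g'
  proof -
    have "g \<otimes> inv g' \<in> normal_core H"
      unfolding normal_core_def
    proof (intro CollectI conjI ballI)
      fix x assume x: "x \<in> carrier G"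
      then have "H #> x \<in> rcosets H"
        by (auto simp: RCOSETS_def)
      then have "H #> x #> g = H #> x #> g'"
        using fun_cong[OF \<open>\<phi> g = \<phi> g'\<close>, of "H #> x"] by (simp add: \<phi>_def)
      then have "x \<otimes> g \<in> H #> (x \<otimes> g')"
        using g x rcos_self[OF _ sH, of "x \<otimes> g"] fin_index_subset[OF H]
        by (simp add: coset_mult_assoc)
      then obtain k where k: "k \<in> H" "x \<otimes> g = k \<otimes> (x \<otimes> g')"
        unfolding r_coset_def by blast
      have "(x \<otimes> g) \<otimes> inv (x \<otimes> g') = k"
        using g x subgroup.mem_carrier[OF sH k(1)] by (simp only: k(2)) (simp add: m_assoc)
      then show "x \<otimes> (g \<otimes> inv g') \<otimes> inv x \<in> H"
        using k(1) g x by (simp add: word_simps)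
    qed (use g in simp)
    then have "(g \<otimes> inv g') \<otimes> g' \<in> normal_core H #> g'"
      unfolding r_coset_def by blast
    then have "g \<in> normal_core H #> g'"
      using g by (simp add: m_assoc)
    then show ?thesis
      using repr_independence[OF _ g(2) N.is_subgroup] by simp
  qed
  \<comment> \<open>By \<open>eq\<close> any preimage of \<phi> g yields the coset of g, so the
    cosets are indexed by values of \<phi>.\<close>
  have "rcosets (normal_core H) \<subseteq> (\<lambda>u. normal_core H #> inv_into (carrier G) \<phi> u) ` \<phi> ` carrier G"
  proof
    fix C assume "C \<in> rcosets (normal_core H)"
    then obtain g where g: "g \<in> carrier G" "C = normal_core H #> g"
      by (auto simp: RCOSETS_def)
    have "\<phi> g \<in> \<phi> ` carrier G"
      using g by blast
    then have "normal_core H #> inv_into (carrier G) \<phi> (\<phi> g) = normal_core H #> g"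
      by (intro eq inv_into_into f_inv_into_f g(1))
    then show "C \<in> (\<lambda>u. normal_core H #> inv_into (carrier G) \<phi> u) ` \<phi> ` carrier G"
      using g by blast
  qed
  then show ?thesis
    by (rule finite_subset) (intro finite_imageI fin_\<phi>)
qed

text \<open>The preimage \<open>P\<close> of a subgroup of the quotient contains \<open>M\<close>,
  so it has finite index and \<open>a\<close> fixes it; hence the image of \<open>a\<close> fixes
  the image of \<open>P\<close>.\<close>

lemma norm_subgroup_Mod:
  assumes a: "a \<in> carrier G" and fixes_H: "\<And>H. H \<in> fin_index_subgroups G \<Longrightarrow> conj_set G a H = H"
    and M: "M \<lhd> G" and fin: "finite (rcosets M)"
  shows "M #> a \<in> norm_subgroup (G Mod M)"
proof -
  interpret M: normal M G
    by (rule M)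
  interpret Q: group_hom G "G Mod M" "\<lambda>a. M #> a"
    by (rule M.group_hom_Mod)
  have "conj_set (G Mod M) (M #> a) S = S" if S: "subgroup S (G Mod M)" for S
  proof -
    define P where "P = {g \<in> carrier G. M #> g \<in> S}"
    have P: "subgroup P G"
    proof (rule subgroupI)
      show "P \<noteq> {}"
        using subgroup.one_closed[OF S] Q.hom_one by (auto simp: P_def intro!: exI[of _ \<one>])
    qed (use subgroup.m_inv_closed[OF S] subgroup.m_closed[OF S]
        in \<open>auto simp del: mult_FactGroup simp: P_def Q.hom_inv\<close>)
    have "M \<subseteq> P"
      using subgroup.one_closed[OF S] M.rcos_const M.subset by (auto simp: P_def)
    moreover have "M \<in> fin_index_subgroups G"
      using fin M.is_subgroup by (simp add: fin_index_subgroups_def)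
    ultimately have "P \<in> fin_index_subgroups G"
      using P fin_index_supergroup by blast
    then have "conj_set G a P = P"
      by (rule fixes_H)
    have SP: "S = (\<lambda>g. M #> g) ` P"
      using subgroup.subset[OF S] by (auto simp: P_def carrier_FactGroup)
    have "conj_set (G Mod M) (M #> a) S
        = (\<lambda>g. (M #> a) \<otimes>\<^bsub>G Mod M\<^esub> (M #> g) \<otimes>\<^bsub>G Mod M\<^esub> inv\<^bsub>G Mod M\<^esub> (M #> a)) ` P"
      by (simp only: Q.H.conj_set_image SP image_image)
    also have "\<dots> = (\<lambda>g. M #> (a \<otimes> g \<otimes> inv a)) ` P"
    proof (rule image_cong)
      fix g assume "g \<in> P"
      then have "g \<in> carrier G"
        by (simp add: P_def)
      then show "(M #> a) \<otimes>\<^bsub>G Mod M\<^esub> (M #> g) \<otimes>\<^bsub>G Mod M\<^esub> inv\<^bsub>G Mod M\<^esub> (M #> a)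
          = M #> (a \<otimes> g \<otimes> inv a)"
        using a by (simp del: mult_FactGroup)
    qed simp
    also have "\<dots> = (\<lambda>g. M #> g) ` conj_set G a P"
      by (simp add: conj_set_image image_image)
    finally show ?thesis
      by (simp add: \<open>conj_set G a P = P\<close> SP)
  qed
  then show ?thesis
    using a by (simp add: norm_subgroup_def)
qed

section \<open>The centre and the second centre\<close>

lemma center_normal: "center G \<lhd> G"
  unfolding normal_inv_iff
proof (intro conjI ballI)
  show "subgroup (center G) G"
  proof (rule subgroupI)
    have "\<one> \<in> center G"
      by (simp add: center_def)
    then show "center G \<noteq> {}"
      by blast
    show "inv z \<in> center G" if "z \<in> center G" for z
    proof -
      have z: "z \<in> carrier G" "\<And>x. x \<in> carrier G \<Longrightarrow> x \<otimes> z = z \<otimes> x"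
        using that by (simp_all add: center_def)
      then have "x \<otimes> inv z = inv z \<otimes> x" if "x \<in> carrier G" for x
        using int_pow_commute[of z x "-1"] that by (simp add: int_pow_neg)
      then show ?thesis
        using z(1) by (simp add: center_def)
    qed
    show "y \<otimes> z \<in> center G" if "y \<in> center G" "z \<in> center G" for y z
    proof -
      have yz: "y \<in> carrier G" "z \<in> carrier G"
        using that by (simp_all add: center_def)
      have "x \<otimes> (y \<otimes> z) = (y \<otimes> z) \<otimes> x" if "x \<in> carrier G" for x
        by (rule commute_mult)
           (use \<open>y \<in> center G\<close> \<open>z \<in> center G\<close> that in \<open>simp_all add: center_def\<close>)
      then show ?thesis
        using yz by (simp add: center_def)
    qed
  qed (auto simp: center_def)
  show "x \<otimes> z \<otimes> inv x \<in> center G" if "x \<in> carrier G" "z \<in> center G" for x z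
  proof -
    have "x \<otimes> z \<otimes> inv x = z"
      using that by (simp add: center_def inv_solve_right')
    then show ?thesis
      using that by simp
  qed
qed

text \<open>Cosets of the centre commute exactly when the commutator of their representatives is
  central.\<close>

lemma mem_second_center_iff:
  "g \<in> second_center G \<longleftrightarrow> g \<in> carrier G \<and> (\<forall>x \<in> carrier G. commutator G g x \<in> center G)"
proof (cases "g \<in> carrier G")
  case True
  interpret Z: normal "center G" G
    by (rule center_normal)
  interpret Q: group "G Mod center G"
    by (rule Z.factorgroup_is_group)
  have "center G #> g \<in> carrier (G Mod center G)" if "g \<in> carrier G" for g
    using that by (simp add: carrier_FactGroup)
  then have "g \<in> second_center G \<longleftrightarrow> (\<forall>x \<in> carrier G.
      commutator (G Mod center G) (center G #> g) (center G #> x) = \<one>\<^bsub>G Mod center G\<^esub>)"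
    using True
    by (simp add: second_center_def center_def[of "G Mod center G"] carrier_FactGroup
        Q.commutator_eq_one_iff del: mult_FactGroup one_FactGroup)
  then show ?thesis
    using True by (simp add: Z.commutator_Mod_eq_one_iff del: one_FactGroup)
qed (simp add: second_center_def)

end

section \<open>The kernel of the action\<close>

context group
begin

text \<open>The vertices detect every moved subgroup; conversely, the action only permutes
  barycentric coordinates, so fixing all vertices fixes all points.\<close>

lemma sg_kernel_eq:
  "sg_kernel G = {g \<in> carrier G. \<forall>H \<in> fin_index_subgroups G. conj_set G g H = H}"
proof -
  have "sg_action G g = (\<lambda>p \<in> sg_space G. p) \<longleftrightarrow> (\<forall>H \<in> fin_index_subgroups G. conj_set G g H = H)"
    if g: "g \<in> carrier G" for g
  proof
    assume eq: "sg_action G g = (\<lambda>p \<in> sg_space G. p)"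
    show "\<forall>H \<in> fin_index_subgroups G. conj_set G g H = H"
    proof
      fix H assume H: "H \<in> fin_index_subgroups G"
      then have "sg_vertex (conj_set G g H) = sg_vertex H"
        using sg_action_vertex[OF g H] sg_vertex_in_space[OF H] by (simp add: eq)
      then have "sg_vertex (conj_set G g H) H = 1"
        by (simp add: sg_vertex_def)
      then show "conj_set G g H = H"
        by (simp add: sg_vertex_def split: if_splits)
    qed
  next
    assume fixes_H: "\<forall>H \<in> fin_index_subgroups G. conj_set G g H = H"
    \<comment> \<open>\<open>sg_action\<close> reads coordinates through the inverse of
      \<open>g\<close>.\<close>
    have "conj_set G (inv g) H = H" if "H \<in> fin_index_subgroups G" for H
      using conj_set_inv(1)[OF g fin_index_subset[OF that]] fixes_H that by simp
    then show "sg_action G g = (\<lambda>p \<in> sg_space G. p)"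
      by (auto simp: sg_action_def sg_space_support intro!: restrict_ext)
  qed
  then show ?thesis
    by (auto simp: sg_kernel_def kernel_def IsomGroup_def BijGroup_def)
qed

lemma group_hom_sg_action:
  "group_hom G (BijGroup (sg_space G)) (sg_action G)"
  using sg_action_group_action by (simp add: group_action_def)

text \<open>\<open>IsomGroup\<close> restricts only the carrier of \<open>BijGroup\<close>, so the
  identity and the kernel agree.\<close>

lemma faithful_iff_sg_kernel:
  "faithful_action G (sg_space G) (sg_action G) \<longleftrightarrow> sg_kernel G = {\<one>}"
proof -
  have "sg_kernel G = kernel G (BijGroup (sg_space G)) (sg_action G)"
    by (simp add: sg_kernel_def kernel_def IsomGroup_def BijGroup_def)
  then show ?thesis
    using group_hom.inj_iff_trivial_ker[OF group_hom_sg_action] sg_action_group_action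
    by (simp add: faithful_action_def faithful_action_axioms_def)
qed

text \<open>In the finite quotient by the core of \<open>H\<close> the image of \<open>g\<close> is
  in the norm, so Schenkman's theorem puts the double commutator in the core.\<close>

lemma sg_kernel_commutator_mem:
  assumes g: "g \<in> sg_kernel G" and x: "x \<in> carrier G" and y: "y \<in> carrier G"
    and H: "H \<in> fin_index_subgroups G"
  shows "commutator G (commutator G g x) y \<in> H"
proof -
  have sH: "subgroup H G"
    using H by (simp add: fin_index_subgroups_def)
  define M where "M = normal_core H"
  interpret M: normal M G
    unfolding M_def using sH by (rule normal_core_normal)
  interpret Q: group "G Mod M"
    by (rule M.factorgroup_is_group)
  have gc: "g \<in> carrier G" and g_fix: "\<And>K. K \<in> fin_index_subgroups G \<Longrightarrow> conj_set G g K = K"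
    using g by (simp_all add: sg_kernel_eq)
  have fin: "finite (rcosets M)"
    unfolding M_def using H by (rule finite_rcosets_normal_core)
  then have fin_Q: "finite (carrier (G Mod M))"
    by (simp add: FactGroup_def)
  have "M #> g \<in> norm_subgroup (G Mod M)"
    using gc g_fix M.normal_axioms fin by (rule norm_subgroup_Mod)
  moreover have "M #> x \<in> carrier (G Mod M)" "M #> y \<in> carrier (G Mod M)"
    using x y by (simp_all add: carrier_FactGroup)
  ultimately have "commutator (G Mod M) (commutator (G Mod M) (M #> g) (M #> x)) (M #> y)
      = \<one>\<^bsub>G Mod M\<^esub>"
    by (rule Q.norm_commutator_commutator[OF fin_Q])
  moreover have "commutator (G Mod M) (M #> g) (M #> x) = M #> commutator G g x"
    using group_hom.hom_commutator[OF M.group_hom_Mod gc x] by simp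
  ultimately have "commutator G (commutator G g x) y \<in> M"
    using M.commutator_Mod_eq_one_iff[of "commutator G g x" y] gc x y by (simp del: one_FactGroup)
  then show ?thesis
    using normal_core_subset[OF sH] by (auto simp: M_def)
qed

lemma sg_kernel_subset_second_center:
  assumes "residually_finite G"
  shows "sg_kernel G \<subseteq> second_center G"
proof
  fix g assume g: "g \<in> sg_kernel G"
  then have gc: "g \<in> carrier G"
    by (simp add: sg_kernel_eq)
  have "commutator G (commutator G g x) y = \<one>" if "x \<in> carrier G" "y \<in> carrier G" for x y
    using assms sg_kernel_commutator_mem[OF g that] unfolding residually_finite_def by blast
  then show "g \<in> second_center G"
    using gc by (simp add: mem_second_center_iff center_def commutator_eq_one_iff)
qed

lemma center_subset_sg_kernel: "center G \<subseteq> sg_kernel G"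
proof
  fix z assume z: "z \<in> center G"
  have "conj_set G z H = H" if H: "H \<in> fin_index_subgroups G" for H
  proof -
    have "z \<otimes> h \<otimes> inv z = h" if "h \<in> H" for h
      using z that fin_index_subset[OF H] by (auto simp: center_def inv_solve_right')
    then show ?thesis
      by (simp add: conj_set_image)
  qed
  then show "z \<in> sg_kernel G"
    using z by (simp add: sg_kernel_eq center_def)
qed

lemma conj_set_self:
  assumes H: "subgroup H G" and h: "h \<in> H"
  shows "conj_set G h H = H"
proof -
  have sub: "conj_set G k H \<subseteq> H" if "k \<in> H" for k
    using H that by (auto simp: conj_set_image subgroup.m_closed subgroup.m_inv_closed)
  have "H = conj_set G h (conj_set G (inv h) H)"
    using conj_set_inv(2)[OF subgroup.mem_carrier[OF H h] subgroup.subset[OF H]] by simp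
  also have "\<dots> \<subseteq> conj_set G h H"
    using sub[OF subgroup.m_inv_closed[OF H h]] by (rule conj_set_mono)
  finally show ?thesis
    using sub[OF h] by blast
qed

lemma Inter_fin_index_subset_sg_kernel: "\<Inter> (fin_index_subgroups G) \<subseteq> sg_kernel G"
proof
  fix g assume g: "g \<in> \<Inter> (fin_index_subgroups G)"
  \<comment> \<open>The whole group has finite index, so the intersection lies in the
    carrier.\<close>
  have "rcosets (carrier G) \<subseteq> {carrier G}"
    using coset_join2[OF _ subgroup_self] by (auto simp: RCOSETS_def)
  then have "carrier G \<in> fin_index_subgroups G"
    using finite_subset by (auto simp: fin_index_subgroups_def subgroup_self)
  then have "g \<in> carrier G"
    using g by blast
  moreover have "conj_set G g H = H" if "H \<in> fin_index_subgroups G" for H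
    using g that by (intro conj_set_self) (auto simp: fin_index_subgroups_def)
  ultimately show "g \<in> sg_kernel G"
    by (simp add: sg_kernel_eq)
qed

text \<open>The kernel contains the centre and the intersection of the finite index subgroups.
  Conversely it lies in the second centre, which is trivial if the centre is.\<close>

lemma sg_kernel_trivial_iff:
  "sg_kernel G = {\<one>} \<longleftrightarrow> residually_finite G \<and> center G = {\<one>}"
proof
  assume K: "sg_kernel G = {\<one>}"
  have "\<one> \<in> \<Inter> (fin_index_subgroups G)"
    by (auto simp: fin_index_subgroups_def subgroup.one_closed)
  moreover have "\<one> \<in> center G"
    by (simp add: center_def)
  ultimately show "residually_finite G \<and> center G = {\<one>}"
    using K center_subset_sg_kernel Inter_fin_index_subset_sg_kernel
    by (auto simp: residually_finite_def)
next
  assume "residually_finite G \<and> center G = {\<one>}"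
  then have rf: "residually_finite G" and Z: "center G = {\<one>}"
    by simp_all
  have "g = \<one>" if g: "g \<in> sg_kernel G" for g
  proof -
    have "g \<in> second_center G"
      using g sg_kernel_subset_second_center[OF rf] by blast
    then have "g \<in> carrier G" "\<And>x. x \<in> carrier G \<Longrightarrow> commutator G g x = \<one>"
      by (simp_all add: mem_second_center_iff Z)
    then have "g \<in> center G"
      by (simp add: center_def commutator_eq_one_iff)
    then show ?thesis
      by (simp add: Z)
  qed
  moreover have "\<one> \<in> sg_kernel G"
    by (simp add: sg_kernel_eq conj_set_one fin_index_subset)
  ultimately show "sg_kernel G = {\<one>}"
    by blast
qed

end

theorem proposition5p5:
  fixes G :: "('a, 'b) monoid_scheme" (structure)
  assumes "group G"
  shows "(residually_finite G \<longrightarrow> sg_kernel G \<subseteq> second_center G) \<and>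
    (faithful_action G (sg_space G) (sg_action G) \<longleftrightarrow>
       residually_finite G \<and> center G = {\<one>})"
proof -
  interpret group G
    by (rule assms)
  show ?thesis
    using sg_kernel_subset_second_center
    by (simp add: faithful_iff_sg_kernel sg_kernel_trivial_iff)
qed

end
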